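(* Let $B$ be a locale. The functor $\mathcal S:B\text{-}\mathbf{LH}\to B\text{-}\mathbf{Sh}$, which is the identity on objects and assigns to each map $f:X\to Y$ of étale $B$-locales the sheaf homomorphism $f_!:X\to Y$, is an isomorphism of categories.
   Context: A locale is a frame; a homomorphism of locales preserves arbitrary joins and finite meets; a map of locales $f:X\to Y$ is a homomorphism $f^*:Y\to X$. A $B$-module is a complete lattice $X$ with an action $B\times X\to X$, $(b,x)\mapsto bx$, preserving arbitrary joins in each variable and satisfying $1x=x$ and $(b\wedge c)x=b(cx)$. A homomorphism of $B$-modules preserves arbitrary joins and the action. A $B$-locale is a locale $X$ equipped with a $B$-module structure such that $bx=b1\wedge x$ for all $b\in B$, $x\in X$. Its projection is the map of locales $p:X\to B$ with $p^*(b)=b1$. A map of $B$-locales $f:X\to Y$ is a function $f^*:Y\to X$ that is both a homomorphism of locales and a homomorphism of $B$-modules. A $B$-locale $X$ is open if $p^*$ has a left adjoint $p_!:X\to B$ which is a homomorphism of $B$-modules; then one writes $\varsigma=p_!$ (the support of $X$). A local section of an open $B$-locale $X$ is an element $s\in X$ such that $\varsigma(x)s=x$ for all $x\le s$; $\mathit{\Gamma}_X$ is the set of local sections. An open $B$-locale $X$ is étale if $\bigvee\mathit{\Gamma}_X=1$; equivalently, $p$ is a local homeomorphism. $B\text{-}\mathbf{LH}$ is the category whose objects are the étale $B$-locales and whose morphisms are the maps of $B$-locales. Any such map $f:X\to Y$ is a local homeomorphism, hence $f^*$ has a left adjoint, denoted $f_!:X\to Y$. A sheaf homomorphism $h:X\to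 Y$ of étale $B$-locales is a homomorphism of $B$-modules such that (1) $h(\mathit{\Gamma}_X)\subset\mathit{\Gamma}_Y$ and (2) $\varsigma(h(s))=\varsigma(s)$ for all $s\in\mathit{\Gamma}_X$. $B\text{-}\mathbf{Sh}$ is the category of étale $B$-locales and sheaf homomorphisms. For every map $f$ of étale $B$-locales, $f_!$ is a sheaf homomorphism, so $\mathcal S$ is well defined. *)

theory Defs
  imports "HOL-Algebra.Galois_Connection" "HOL-Library.FuncSet"
begin

section \<open>Categories, functors and isomorphisms of categories\<close>

text \<open>
  Categories are given by hom-sets indexed by pairs of objects. The hom-sets need not be disjoint,
  so composition and the arrow map of a functor take the objects involved as arguments:
  \<open>Comp C X Y Z g f\<close> is the composite of \<open>f : X \<rightarrow> Y\<close> followed by \<open>g : Y \<rightarrow> Z\<close>.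
\<close>

record ('o, 'm) category =
  Obj :: "'o set"
  Hom :: "'o \<Rightarrow> 'o \<Rightarrow> 'm set"
  Ident :: "'o \<Rightarrow> 'm"
  Comp :: "'o \<Rightarrow> 'o \<Rightarrow> 'o \<Rightarrow> 'm \<Rightarrow> 'm \<Rightarrow> 'm"

locale is_category =
  fixes C :: "('o, 'm) category"
  assumes ident_in_hom: "X \<in> Obj C \<Longrightarrow> Ident C X \<in> Hom C X X"
    and comp_in_hom:
      "\<lbrakk>X \<in> Obj C; Y \<in> Obj C; Z \<in> Obj C; f \<in> Hom C X Y; g \<in> Hom C Y Z\<rbrakk>
        \<Longrightarrow> Comp C X Y Z g f \<in> Hom C X Z"
    and comp_ident_right:
      "\<lbrakk>X \<in> Obj C; Y \<in> Obj C; f \<in> Hom C X Y\<rbrakk> \<Longrightarrow> Comp C X X Y f (Ident C X) = f"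
    and comp_ident_left:
      "\<lbrakk>X \<in> Obj C; Y \<in> Obj C; f \<in> Hom C X Y\<rbrakk> \<Longrightarrow> Comp C X Y Y (Ident C Y) f = f"
    and comp_assoc:
      "\<lbrakk>W \<in> Obj C; X \<in> Obj C; Y \<in> Obj C; Z \<in> Obj C;
        f \<in> Hom C W X; g \<in> Hom C X Y; h \<in> Hom C Y Z\<rbrakk>
        \<Longrightarrow> Comp C W Y Z h (Comp C W X Y g f) = Comp C W X Z (Comp C X Y Z h g) f"

record ('o, 'm, 'p, 'n) functor_data =
  ObjMap :: "'o \<Rightarrow> 'p"
  ArrMap :: "'o \<Rightarrow> 'o \<Rightarrow> 'm \<Rightarrow> 'n"

locale is_functor = C: is_category C + D: is_category D
  for C :: "('o, 'm) category" and D :: "('p, 'n) category" +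
  fixes F :: "('o, 'm, 'p, 'n) functor_data"
  assumes obj_map: "X \<in> Obj C \<Longrightarrow> ObjMap F X \<in> Obj D"
    and arr_map:
      "\<lbrakk>X \<in> Obj C; Y \<in> Obj C; f \<in> Hom C X Y\<rbrakk>
        \<Longrightarrow> ArrMap F X Y f \<in> Hom D (ObjMap F X) (ObjMap F Y)"
    and map_ident: "X \<in> Obj C \<Longrightarrow> ArrMap F X X (Ident C X) = Ident D (ObjMap F X)"
    and map_comp:
      "\<lbrakk>X \<in> Obj C; Y \<in> Obj C; Z \<in> Obj C; f \<in> Hom C X Y; g \<in> Hom C Y Z\<rbrakk>
        \<Longrightarrow> ArrMap F X Z (Comp C X Y Z g f) =
            Comp D (ObjMap F X) (ObjMap F Y) (ObjMap F Z) (ArrMap F Y Z g) (ArrMap F X Y f)"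

definition comp_is_identity ::
  "('o, 'm) category \<Rightarrow> ('o, 'm, 'p, 'n) functor_data \<Rightarrow> ('p, 'n, 'o, 'm) functor_data \<Rightarrow> bool"
  where "comp_is_identity C F G \<longleftrightarrow>
    (\<forall>X\<in>Obj C. ObjMap G (ObjMap F X) = X) \<and>
    (\<forall>X\<in>Obj C. \<forall>Y\<in>Obj C. \<forall>f\<in>Hom C X Y.
      ArrMap G (ObjMap F X) (ObjMap F Y) (ArrMap F X Y f) = f)"

definition iso_of_categories ::
  "('o, 'm) category \<Rightarrow> ('p, 'n) category \<Rightarrow> ('o, 'm, 'p, 'n) functor_data \<Rightarrow> bool"
  where "iso_of_categories C D F \<longleftrightarrow>
    is_functor C D F \<and>
    (\<exists>G. is_functor D C G \<and> comp_is_identity C F G \<and> comp_is_identity D G F)"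


section \<open>Frames and adjoints\<close>

text \<open>
  A locale \<open>X\<close> is represented by its frame, and a map of locales \<open>f : X \<rightarrow> Y\<close> by the frame
  homomorphism \<open>f\<^sup>* : Y \<rightarrow> X\<close>. All homomorphisms are extensional functions on the carrier, so that
  equality of morphisms is equality of HOL functions.
\<close>

locale frame = complete_lattice L for L (structure) +
  assumes meet_Sup_distrib:
    "\<lbrakk>a \<in> carrier L; S \<subseteq> carrier L\<rbrakk> \<Longrightarrow> a \<sqinter> (\<Squnion>S) = \<Squnion>((\<lambda>s. a \<sqinter> s) ` S)"

text \<open>\<open>sup_pres\<close> covers the empty join, hence the bottom element.\<close>

definition frame_hom :: "('a, 'c) gorder_scheme \<Rightarrow> ('b, 'd) gorder_scheme \<Rightarrow> ('a \<Rightarrow> 'b) set"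
  where "frame_hom Y X = {f \<in> carrier Y \<rightarrow>\<^sub>E carrier X.
    sup_pres Y X f \<and> f \<top>\<^bsub>Y\<^esub> = \<top>\<^bsub>X\<^esub> \<and> meet_pres Y X f}"

definition is_left_adjoint ::
  "('a, 'c) gorder_scheme \<Rightarrow> ('b, 'd) gorder_scheme \<Rightarrow> ('b \<Rightarrow> 'a) \<Rightarrow> ('a \<Rightarrow> 'b) \<Rightarrow> bool"
  where "is_left_adjoint X Y u l \<longleftrightarrow>
    l \<in> extensional (carrier X) \<and>
    galois_connection \<lparr>orderA = X, orderB = Y, lower = l, upper = u\<rparr>"

definition left_adjoint ::
  "('a, 'c) gorder_scheme \<Rightarrow> ('b, 'd) gorder_scheme \<Rightarrow> ('b \<Rightarrow> 'a) \<Rightarrow> ('a \<Rightarrow> 'b)"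
  where "left_adjoint X Y u = (THE l. is_left_adjoint X Y u l)"

lemma is_left_adjoint_unique:
  assumes "is_left_adjoint X Y u l" "is_left_adjoint X Y u l'"
  shows "l = l'"
proof (rule extensionalityI)
  show "l \<in> extensional (carrier X)" "l' \<in> extensional (carrier X)"
    using assms by (auto simp: is_left_adjoint_def)
next
  fix x assume x: "x \<in> carrier X"
  interpret a: galois_connection "\<lparr>orderA = X, orderB = Y, lower = l, upper = u\<rparr>"
    using assms by (simp add: is_left_adjoint_def)
  interpret b: galois_connection "\<lparr>orderA = X, orderB = Y, lower = l', upper = u\<rparr>"
    using assms by (simp add: is_left_adjoint_def)
  interpret po: partial_order Y
    using a.is_order_B by simp
  have l: "l x \<in> carrier Y" "l' x \<in> carrier Y"
    using a.lower_closed b.lower_closed x by auto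
  have "l x \<sqsubseteq>\<^bsub>Y\<^esub> l' x" "l' x \<sqsubseteq>\<^bsub>Y\<^esub> l x"
    using a.galois_property[of x "l' x"] b.galois_property[of x "l' x"]
      a.galois_property[of x "l x"] b.galois_property[of x "l x"] x l by auto
  then show "l x = l' x"
    using l by (intro po.le_antisym)
qed

lemma left_adjoint_eq:
  assumes "is_left_adjoint X Y u l"
  shows "left_adjoint X Y u = l"
  unfolding left_adjoint_def using assms is_left_adjoint_unique by blast


section \<open>Modules and locales over a base\<close>

record ('b, 'a) bmod = "'a gorder" +
  act :: "'b \<Rightarrow> 'a \<Rightarrow> 'a" (infixr \<open>\<cdot>\<index>\<close> 75)

locale bmodule = B: frame B + X: complete_lattice X
  for B :: "('b, 'c) gorder_scheme" and X :: "('b, 'a) bmod" +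
  assumes act_closed: "\<lbrakk>b \<in> carrier B; x \<in> carrier X\<rbrakk> \<Longrightarrow> b \<cdot>\<^bsub>X\<^esub> x \<in> carrier X"
    and act_Sup_left:
      "\<lbrakk>S \<subseteq> carrier B; x \<in> carrier X\<rbrakk> \<Longrightarrow> (\<Squnion>\<^bsub>B\<^esub>S) \<cdot>\<^bsub>X\<^esub> x = \<Squnion>\<^bsub>X\<^esub>((\<lambda>b. b \<cdot>\<^bsub>X\<^esub> x) ` S)"
    and act_Sup_right:
      "\<lbrakk>b \<in> carrier B; T \<subseteq> carrier X\<rbrakk> \<Longrightarrow> b \<cdot>\<^bsub>X\<^esub> (\<Squnion>\<^bsub>X\<^esub>T) = \<Squnion>\<^bsub>X\<^esub>((\<lambda>x. b \<cdot>\<^bsub>X\<^esub> x) ` T)"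
    and act_top: "x \<in> carrier X \<Longrightarrow> \<top>\<^bsub>B\<^esub> \<cdot>\<^bsub>X\<^esub> x = x"
    and act_meet:
      "\<lbrakk>b \<in> carrier B; c \<in> carrier B; x \<in> carrier X\<rbrakk> \<Longrightarrow> (b \<sqinter>\<^bsub>B\<^esub> c) \<cdot>\<^bsub>X\<^esub> x = b \<cdot>\<^bsub>X\<^esub> (c \<cdot>\<^bsub>X\<^esub> x)"

definition bmodule_hom ::
  "('b, 'c) gorder_scheme \<Rightarrow> ('b, 'x) bmod \<Rightarrow> ('b, 'y) bmod \<Rightarrow> ('x \<Rightarrow> 'y) set"
  where "bmodule_hom B X Y = {h \<in> carrier X \<rightarrow>\<^sub>E carrier Y.
    sup_pres X Y h \<and>
    (\<forall>b\<in>carrier B. \<forall>x\<in>carrier X. h (b \<cdot>\<^bsub>X\<^esub> x) = b \<cdot>\<^bsub>Y\<^esub> h x)}"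

definition base_module :: "('b, 'c) gorder_scheme \<Rightarrow> ('b, 'b) bmod"
  where "base_module B = \<lparr>carrier = carrier B, eq = eq B, le = le B, act = meet B\<rparr>"

locale blocale = bmodule B X + XF: frame X
  for B :: "('b, 'c) gorder_scheme" and X :: "('b, 'a) bmod" +
  assumes act_eq_meet:
    "\<lbrakk>b \<in> carrier B; x \<in> carrier X\<rbrakk> \<Longrightarrow> b \<cdot>\<^bsub>X\<^esub> x = (b \<cdot>\<^bsub>X\<^esub> \<top>\<^bsub>X\<^esub>) \<sqinter>\<^bsub>X\<^esub> x"

text \<open>The inverse image \<open>p\<^sup>*\<close> of the projection \<open>p : X \<rightarrow> B\<close>.\<close>

definition proj_inv :: "('b, 'c) gorder_scheme \<Rightarrow> ('b, 'a) bmod \<Rightarrow> 'b \<Rightarrow> 'a"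
  where "proj_inv B X = (\<lambda>b\<in>carrier B. b \<cdot>\<^bsub>X\<^esub> \<top>\<^bsub>X\<^esub>)"

definition blocale_maps ::
  "('b, 'c) gorder_scheme \<Rightarrow> ('b, 'x) bmod \<Rightarrow> ('b, 'y) bmod \<Rightarrow> ('y \<Rightarrow> 'x) set"
  where "blocale_maps B X Y = frame_hom Y X \<inter> bmodule_hom B Y X"

locale open_blocale = blocale B X
  for B :: "('b, 'c) gorder_scheme" and X :: "('b, 'a) bmod" +
  assumes ex_direct_image:
    "\<exists>l. is_left_adjoint X B (proj_inv B X) l \<and> l \<in> bmodule_hom B X (base_module B)"

definition supp :: "('b, 'c) gorder_scheme \<Rightarrow> ('b, 'a) bmod \<Rightarrow> 'a \<Rightarrow> 'b"
  where "supp B X = left_adjoint X B (proj_inv B X)"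

definition local_sections :: "('b, 'c) gorder_scheme \<Rightarrow> ('b, 'a) bmod \<Rightarrow> 'a set"
  where "local_sections B X =
    {s \<in> carrier X. \<forall>x\<in>carrier X. x \<sqsubseteq>\<^bsub>X\<^esub> s \<longrightarrow> supp B X x \<cdot>\<^bsub>X\<^esub> s = x}"

locale etale_blocale = open_blocale B X
  for B :: "('b, 'c) gorder_scheme" and X :: "('b, 'a) bmod" +
  assumes Sup_local_sections: "\<Squnion>\<^bsub>X\<^esub>(local_sections B X) = \<top>\<^bsub>X\<^esub>"

definition sheaf_hom ::
  "('b, 'c) gorder_scheme \<Rightarrow> ('b, 'x) bmod \<Rightarrow> ('b, 'y) bmod \<Rightarrow> ('x \<Rightarrow> 'y) set"
  where "sheaf_hom B X Y = {h \<in> bmodule_hom B X Y.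
    h ` local_sections B X \<subseteq> local_sections B Y \<and>
    (\<forall>s\<in>local_sections B X. supp B Y (h s) = supp B X s)}"


section \<open>The two categories and the comparison functor\<close>

text \<open>
  The objects are all etale \<open>B\<close>-locales whose carrier is a subset of an arbitrary type \<open>'a\<close>, which
  plays the role of the universe. Records differing only outside their carriers count as different
  objects.
\<close>

text \<open>
  An arrow \<open>f : X \<rightarrow> Y\<close> of \<open>LH B\<close> is given by \<open>f\<^sup>* : Y \<rightarrow> X\<close>, so that the composite of \<open>f\<close>
  followed by \<open>g : Y \<rightarrow> Z\<close> is given by \<open>f\<^sup>* \<circ> g\<^sup>*\<close>, a function on the carrier of \<open>Z\<close>.
\<close>

definition LH :: "('b, 'c) gorder_scheme \<Rightarrow> (('b, 'a) bmod, 'a \<Rightarrow> 'a) category"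
  where "LH B =
    \<lparr>Obj = {X. etale_blocale B X},
     Hom = blocale_maps B,
     Ident = (\<lambda>X. \<lambda>x\<in>carrier X. x),
     Comp = (\<lambda>X Y Z g f. compose (carrier Z) f g)\<rparr>"

definition Sh :: "('b, 'c) gorder_scheme \<Rightarrow> (('b, 'a) bmod, 'a \<Rightarrow> 'a) category"
  where "Sh B =
    \<lparr>Obj = {X. etale_blocale B X},
     Hom = sheaf_hom B,
     Ident = (\<lambda>X. \<lambda>x\<in>carrier X. x),
     Comp = (\<lambda>X Y Z g f. compose (carrier X) g f)\<rparr>"

definition S_functor ::
  "(('b, 'a) bmod, 'a \<Rightarrow> 'a, ('b, 'a) bmod, 'a \<Rightarrow> 'a) functor_data"
  where "S_functor =
    \<lparr>ObjMap = (\<lambda>X. X),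
     ArrMap = (\<lambda>X Y f. left_adjoint X Y f)\<rparr>"

end

theory Submission
  imports Defs
begin

text \<open>
  A map \<open>f\<close> is determined by \<open>f\<^sub>!\<close> and conversely, being adjoint; the point is that every \<open>f\<^sup>*\<close> has a
  left adjoint, that this is a sheaf homomorphism, and that all sheaf homomorphisms arise so. On the
  elements \<open>s \<le> f\<^sup>* t\<close> with \<open>t\<close> a local section, which cover \<open>X\<close>, one must have
  \<open>f\<^sub>! s = \<sigma>(s) t\<close>; this yields existence of \<open>f\<^sub>!\<close> and the Frobenius law
  \<open>f\<^sub>! (f\<^sup>* y \<and> x) = y \<and> f\<^sub>! x\<close>, from which linearity and preservation of local sections follow.
  Conversely, the right adjoint of a sheaf homomorphism \<open>h\<close> preserves joins because
  \<open>h(s) \<le> \<Squnion>y\<^sub>i\<close> splits a local section \<open>s\<close> into pieces \<open>b\<^sub>i s\<close> with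
  \<open>b\<^sub>i = \<sigma>(h(s) \<and> y\<^sub>i)\<close> and \<open>h(b\<^sub>i s) \<le> y\<^sub>i\<close>.
\<close>

section \<open>Complete lattices and adjoints\<close>

context complete_lattice
begin

lemma le_meet_iff:
  assumes "x \<in> carrier L" "y \<in> carrier L" "z \<in> carrier L"
  shows "z \<sqsubseteq> x \<sqinter> y \<longleftrightarrow> z \<sqsubseteq> x \<and> z \<sqsubseteq> y"
  using assms by (meson meet_closed meet_le meet_left meet_right le_trans)

lemma meet_eq_left:
  assumes "x \<in> carrier L" "y \<in> carrier L" "x \<sqsubseteq> y"
  shows "x \<sqinter> y = x"
  using assms by (intro le_antisym) (simp_all add: le_meet_iff meet_left)

lemma sup_le_iff:
  assumes "A \<subseteq> carrier L" "z \<in> carrier L"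
  shows "\<Squnion>A \<sqsubseteq> z \<longleftrightarrow> (\<forall>a\<in>A. a \<sqsubseteq> z)"
  using assms by (meson le_trans sup_closed sup_least sup_upper subsetD)

lemma le_inf_iff:
  assumes "A \<subseteq> carrier L" "z \<in> carrier L"
  shows "z \<sqsubseteq> \<Sqinter>A \<longleftrightarrow> (\<forall>a\<in>A. z \<sqsubseteq> a)"
  using assms by (meson le_trans inf_closed inf_greatest inf_lower subsetD)

text \<open>The Yoneda principle for posets. A left adjoint is known only through the elements above
  its values, so identities involving one are checked this way; the dual below serves right
  adjoints, meets and actions.\<close>

lemma eq_iff_upper:
  assumes "x \<in> carrier L" "y \<in> carrier L"
    and "\<And>z. z \<in> carrier L \<Longrightarrow> x \<sqsubseteq> z \<longleftrightarrow> y \<sqsubseteq> z"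
  shows "x = y"
  using assms by (meson le_antisym le_refl)

lemma eq_iff_lower:
  assumes "x \<in> carrier L" "y \<in> carrier L"
    and "\<And>z. z \<in> carrier L \<Longrightarrow> z \<sqsubseteq> x \<longleftrightarrow> z \<sqsubseteq> y"
  shows "x = y"
  using assms by (meson le_antisym le_refl)

end

lemma (in frame) eq_Sup_meet_cover:
  assumes "x \<in> carrier L" "U \<subseteq> carrier L" "\<Squnion>U = \<top>"
  shows "\<Squnion>((\<lambda>u. x \<sqinter> u) ` U) = x"
  using meet_Sup_distrib[OF assms(1,2)] assms meet_eq_left[of x \<top>] by simp

text \<open>Inequalities are local: \<open>x\<close> is the join of its pieces
  \<open>x \<sqinter> u\<close>, so a bound on every piece bounds \<open>x\<close>.\<close>

lemma (in frame) le_if_cover: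
  assumes "x \<in> carrier L" "z \<in> carrier L" "U \<subseteq> carrier L" "\<Squnion>U = \<top>"
    and "\<And>u. u \<in> U \<Longrightarrow> x \<sqinter> u \<sqsubseteq> z"
  shows "x \<sqsubseteq> z"
proof -
  have "(\<lambda>u. x \<sqinter> u) ` U \<subseteq> carrier L" using assms by auto
  then have "\<Squnion>((\<lambda>u. x \<sqinter> u) ` U) \<sqsubseteq> z"
    using assms by (simp add: sup_le_iff)
  then show ?thesis using eq_Sup_meet_cover assms by simp
qed

lemma is_left_adjointI:
  assumes "partial_order X" "partial_order Y"
    and "l \<in> carrier X \<rightarrow>\<^sub>E carrier Y" "u \<in> carrier Y \<rightarrow> carrier X"
    and "\<And>x y. \<lbrakk>x \<in> carrier X; y \<in> carrier Y\<rbrakk> \<Longrightarrow> l x \<sqsubseteq>\<^bsub>Y\<^esub> y \<longleftrightarrow> x \<sqsubseteq>\<^bsub>X\<^esub> u y"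
  shows "is_left_adjoint X Y u l"
  using assms
  by (auto simp: is_left_adjoint_def galois_connection_def galois_connection_axioms_def
      connection_def PiE_def)

lemma is_left_adjointD:
  assumes "is_left_adjoint X Y u l"
  shows "l \<in> carrier X \<rightarrow>\<^sub>E carrier Y" "u \<in> carrier Y \<rightarrow> carrier X"
    and "\<lbrakk>x \<in> carrier X; y \<in> carrier Y\<rbrakk> \<Longrightarrow> l x \<sqsubseteq>\<^bsub>Y\<^esub> y \<longleftrightarrow> x \<sqsubseteq>\<^bsub>X\<^esub> u y"
  using assms
  by (auto simp: is_left_adjoint_def galois_connection_def galois_connection_axioms_def
      connection_def PiE_def)

text \<open>Both sides have the same upper bounds: \<open>l (\<Squnion>A)\<close> is below
  \<open>z\<close> iff every \<open>a\<close> in \<open>A\<close> is below \<open>u z\<close>, iff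
  every \<open>l a\<close> is below \<open>z\<close>.\<close>

lemma is_left_adjoint_sup_pres:
  assumes adj: "is_left_adjoint X Y u l" and "complete_lattice X" "complete_lattice Y"
  shows "sup_pres X Y l"
proof -
  interpret X: complete_lattice X by fact
  interpret Y: complete_lattice Y by fact
  note [simp] = is_left_adjointD(3)[OF adj]
  have l: "l x \<in> carrier Y" if "x \<in> carrier X" for x
    using is_left_adjointD(1)[OF adj] that by auto
  have u: "u y \<in> carrier X" if "y \<in> carrier Y" for y
    using is_left_adjointD(2)[OF adj] that by auto
  have "l (\<Squnion>\<^bsub>X\<^esub>A) = \<Squnion>\<^bsub>Y\<^esub>(l ` A)" if A: "A \<subseteq> carrier X" for A
  proof (rule Y.eq_iff_upper)
    have lA: "l ` A \<subseteq> carrier Y" using A l by auto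
    then show "l (\<Squnion>\<^bsub>X\<^esub>A) \<in> carrier Y" "\<Squnion>\<^bsub>Y\<^esub>(l ` A) \<in> carrier Y"
      using A l by auto
    fix z assume z: "z \<in> carrier Y"
    show "l (\<Squnion>\<^bsub>X\<^esub>A) \<sqsubseteq>\<^bsub>Y\<^esub> z \<longleftrightarrow> \<Squnion>\<^bsub>Y\<^esub>(l ` A) \<sqsubseteq>\<^bsub>Y\<^esub> z"
      using A z lA u[OF z] by (simp add: Y.sup_le_iff X.sup_le_iff subset_iff)
  qed
  then show ?thesis
    using assms by (simp add: sup_pres_def)
qed

text \<open>The adjunction fixes \<open>u\<close> on the carrier only, and extensionality fixes it
  elsewhere. This gives injectivity of the passage from f^* to f_! as an equality of HOL
  functions.\<close>

lemma is_left_adjoint_upper_unique: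
  assumes "is_left_adjoint X Y u l" "is_left_adjoint X Y u' l"
    and "u \<in> extensional (carrier Y)" "u' \<in> extensional (carrier Y)"
  shows "u = u'"
proof (rule extensionalityI[OF assms(3,4)])
  interpret partial_order X
    using assms(1) by (simp add: is_left_adjoint_def galois_connection_def connection_def)
  fix y assume y: "y \<in> carrier Y"
  then have "u y \<in> carrier X" "u' y \<in> carrier X"
    using assms(1,2)[THEN is_left_adjointD(2)] by auto
  then show "u y = u' y"
    using assms(1,2)[THEN is_left_adjointD(3)] y by (meson le_antisym le_refl)
qed

lemma is_left_adjoint_id:
  assumes "partial_order X"
  shows "is_left_adjoint X X (\<lambda>x\<in>carrier X. x) (\<lambda>x\<in>carrier X. x)"
  using assms by (intro is_left_adjointI) auto

text \<open>Chain the equivalences \<open>m (l x) \<le> z\<close> iff \<open>l x \<le> v z\<close>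
  iff \<open>x \<le> u (v z)\<close>. Upper adjoints compose in the opposite order to lower ones,
  which matches the reversed composition in \<open>LH\<close>.\<close>

lemma is_left_adjoint_compose:
  assumes "is_left_adjoint X Y u l" "is_left_adjoint Y Z v m"
  shows "is_left_adjoint X Z (compose (carrier Z) u v) (compose (carrier X) m l)"
proof (rule is_left_adjointI)
  show "partial_order X" "partial_order Z"
    using assms by (simp_all add: is_left_adjoint_def galois_connection_def connection_def)
  note D = assms[THEN is_left_adjointD(1)] assms[THEN is_left_adjointD(2)]
  then show "compose (carrier X) m l \<in> carrier X \<rightarrow>\<^sub>E carrier Z"
    "compose (carrier Z) u v \<in> carrier Z \<rightarrow> carrier X"
    by (auto simp: compose_def PiE_def)
  fix x z assume "x \<in> carrier X" "z \<in> carrier Z"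
  moreover from this have "l x \<in> carrier Y" "v z \<in> carrier Y"
    using D by auto
  ultimately show "compose (carrier X) m l x \<sqsubseteq>\<^bsub>Z\<^esub> z \<longleftrightarrow> x \<sqsubseteq>\<^bsub>X\<^esub> compose (carrier Z) u v z"
    using assms[THEN is_left_adjointD(3)] by (simp add: compose_eq)
qed


section \<open>Supports and local sections\<close>

context bmodule
begin

lemma act_mono_right:
  assumes "b \<in> carrier B" "x \<in> carrier X" "y \<in> carrier X" "x \<sqsubseteq>\<^bsub>X\<^esub> y"
  shows "b \<cdot>\<^bsub>X\<^esub> x \<sqsubseteq>\<^bsub>X\<^esub> b \<cdot>\<^bsub>X\<^esub> y"
proof -
  \<comment> \<open>Comparability is expressed as a binary join, which the action preserves.\<close>
  have "\<Squnion>\<^bsub>X\<^esub>{x, y} = y"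
    using assms by (intro X.eq_iff_upper) (auto simp: X.sup_le_iff intro: X.le_trans)
  then have "b \<cdot>\<^bsub>X\<^esub> y = \<Squnion>\<^bsub>X\<^esub>{b \<cdot>\<^bsub>X\<^esub> x, b \<cdot>\<^bsub>X\<^esub> y}"
    using act_Sup_right[of b "{x, y}"] assms by simp
  then show ?thesis
    using X.sup_upper[of "{b \<cdot>\<^bsub>X\<^esub> x, b \<cdot>\<^bsub>X\<^esub> y}" "b \<cdot>\<^bsub>X\<^esub> x"] assms act_closed by simp
qed

end

context open_blocale
begin

text \<open>The axiom only asserts that some suitable left adjoint exists; uniqueness of left
  adjoints identifies it with \<open>supp\<close>.\<close>

lemma supp_adjoint: "is_left_adjoint X B (proj_inv B X) (supp B X)"
  and supp_hom: "supp B X \<in> bmodule_hom B X (base_module B)"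
proof -
  obtain l where "is_left_adjoint X B (proj_inv B X) l" "l \<in> bmodule_hom B X (base_module B)"
    using ex_direct_image by blast
  moreover from this(1) have "supp B X = l"
    unfolding supp_def by (rule left_adjoint_eq)
  ultimately show "is_left_adjoint X B (proj_inv B X) (supp B X)"
    "supp B X \<in> bmodule_hom B X (base_module B)" by simp_all
qed

lemma supp_closed: "x \<in> carrier X \<Longrightarrow> supp B X x \<in> carrier B"
  using is_left_adjointD(1)[OF supp_adjoint] by auto

lemma supp_le_iff:
  "\<lbrakk>x \<in> carrier X; b \<in> carrier B\<rbrakk> \<Longrightarrow> supp B X x \<sqsubseteq>\<^bsub>B\<^esub> b \<longleftrightarrow> x \<sqsubseteq>\<^bsub>X\<^esub> b \<cdot>\<^bsub>X\<^esub> \<top>\<^bsub>X\<^esub>"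
  using is_left_adjointD(3)[OF supp_adjoint] by (simp add: proj_inv_def)

lemma supp_act:
  "\<lbrakk>b \<in> carrier B; x \<in> carrier X\<rbrakk> \<Longrightarrow> supp B X (b \<cdot>\<^bsub>X\<^esub> x) = b \<sqinter>\<^bsub>B\<^esub> supp B X x"
  using supp_hom by (simp add: bmodule_hom_def base_module_def)

lemma supp_Sup:
  "A \<subseteq> carrier X \<Longrightarrow> supp B X (\<Squnion>\<^bsub>X\<^esub>A) = \<Squnion>\<^bsub>B\<^esub>(supp B X ` A)"
  using is_left_adjoint_sup_pres[OF supp_adjoint X.complete_lattice_axioms B.complete_lattice_axioms]
  by (simp add: sup_pres_def)

text \<open>Write \<open>b \<cdot> x\<close> as the meet of \<open>b \<cdot> \<top>\<close> and
  \<open>x\<close>; by adjunction, lying below \<open>b \<cdot> \<top>\<close> is a bound on the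
  support. Most facts about the action are read off from this description of the elements below
  \<open>b \<cdot> x\<close>.\<close>

lemma le_act_iff:
  assumes "b \<in> carrier B" "x \<in> carrier X" "z \<in> carrier X"
  shows "z \<sqsubseteq>\<^bsub>X\<^esub> b \<cdot>\<^bsub>X\<^esub> x \<longleftrightarrow> supp B X z \<sqsubseteq>\<^bsub>B\<^esub> b \<and> z \<sqsubseteq>\<^bsub>X\<^esub> x"
  using assms act_eq_meet[of b x] by (simp add: X.le_meet_iff supp_le_iff act_closed)

lemma act_le: "\<lbrakk>b \<in> carrier B; x \<in> carrier X\<rbrakk> \<Longrightarrow> b \<cdot>\<^bsub>X\<^esub> x \<sqsubseteq>\<^bsub>X\<^esub> x"
  using le_act_iff[of b x "b \<cdot>\<^bsub>X\<^esub> x"] act_closed[of b x] X.le_refl[of "b \<cdot>\<^bsub>X\<^esub> x"] by blast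

lemma act_mono_left:
  assumes "b \<in> carrier B" "c \<in> carrier B" "x \<in> carrier X" "b \<sqsubseteq>\<^bsub>B\<^esub> c"
  shows "b \<cdot>\<^bsub>X\<^esub> x \<sqsubseteq>\<^bsub>X\<^esub> c \<cdot>\<^bsub>X\<^esub> x"
proof -
  have "b \<cdot>\<^bsub>X\<^esub> x \<in> carrier X" "supp B X (b \<cdot>\<^bsub>X\<^esub> x) \<in> carrier B"
    using assms act_closed supp_closed by auto
  moreover from this have "supp B X (b \<cdot>\<^bsub>X\<^esub> x) \<sqsubseteq>\<^bsub>B\<^esub> b" "b \<cdot>\<^bsub>X\<^esub> x \<sqsubseteq>\<^bsub>X\<^esub> x"
    using le_act_iff[of b x "b \<cdot>\<^bsub>X\<^esub> x"] assms by auto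
  ultimately show ?thesis
    using assms by (metis le_act_iff B.le_trans)
qed

text \<open>Take \<open>b\<close> to be the support of \<open>x\<close> in
  \<open>le_act_iff\<close>. Since this half holds for every \<open>y\<close>, being a local section
  amounts to the reverse inequality.\<close>

lemma act_supp_of_le:
  assumes "x \<in> carrier X" "y \<in> carrier X" "x \<sqsubseteq>\<^bsub>X\<^esub> y"
  shows "x \<sqsubseteq>\<^bsub>X\<^esub> supp B X x \<cdot>\<^bsub>X\<^esub> y"
  using assms le_act_iff[of "supp B X x" y x] supp_closed[of x] B.le_refl by blast

lemma act_supp: "x \<in> carrier X \<Longrightarrow> supp B X x \<cdot>\<^bsub>X\<^esub> x = x"
  using act_le[of "supp B X x" x] act_supp_of_le[of x x] act_closed supp_closed
  by (intro X.le_antisym) auto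

lemma act_meet_distrib:
  assumes "b \<in> carrier B" "x \<in> carrier X" "y \<in> carrier X"
  shows "b \<cdot>\<^bsub>X\<^esub> x \<sqinter>\<^bsub>X\<^esub> y = b \<cdot>\<^bsub>X\<^esub> (x \<sqinter>\<^bsub>X\<^esub> y)"
  using assms
  by (intro X.eq_iff_lower) (simp_all add: X.le_meet_iff le_act_iff act_closed conj_assoc)

lemma local_sections_carrier: "local_sections B X \<subseteq> carrier X"
  by (auto simp: local_sections_def)

lemma local_section_eq:
  "\<lbrakk>s \<in> local_sections B X; x \<in> carrier X; x \<sqsubseteq>\<^bsub>X\<^esub> s\<rbrakk> \<Longrightarrow> supp B X x \<cdot>\<^bsub>X\<^esub> s = x"
  by (simp add: local_sections_def)

text \<open>For \<open>x \<le> t \<le> s\<close>, monotonicity of the action bounds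
  \<open>supp B X x \<cdot> t\<close> by \<open>supp B X x \<cdot> s\<close>, which equals
  \<open>x\<close> because \<open>s\<close> is a local section.\<close>

lemma local_section_downward:
  assumes s: "s \<in> local_sections B X" and t: "t \<in> carrier X" "t \<sqsubseteq>\<^bsub>X\<^esub> s"
  shows "t \<in> local_sections B X"
proof -
  have sc: "s \<in> carrier X" using s local_sections_carrier by auto
  have "supp B X x \<cdot>\<^bsub>X\<^esub> t = x" if x: "x \<in> carrier X" "x \<sqsubseteq>\<^bsub>X\<^esub> t" for x
  proof (rule X.le_antisym)
    have "x \<sqsubseteq>\<^bsub>X\<^esub> s" using x t sc by (meson X.le_trans)
    then have "supp B X x \<cdot>\<^bsub>X\<^esub> s = x" using local_section_eq[OF s] x by blast
    then show "supp B X x \<cdot>\<^bsub>X\<^esub> t \<sqsubseteq>\<^bsub>X\<^esub> x"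
      using act_mono_right[of "supp B X x" t s] x sc t supp_closed by simp
  qed (use x t act_supp_of_le act_closed supp_closed in auto)
  then show ?thesis using t by (simp add: local_sections_def)
qed

end


section \<open>The direct image of a map of etale \<open>B\<close>-locales\<close>

locale blocale_map = X: etale_blocale B X + Y: etale_blocale B Y
  for B :: "('b, 'c) gorder_scheme" and X :: "('b, 'x) bmod" and Y :: "('b, 'y) bmod" +
  fixes f :: "'y \<Rightarrow> 'x"
  assumes map: "f \<in> blocale_maps B X Y"
begin

lemma f_closed [simp]: "y \<in> carrier Y \<Longrightarrow> f y \<in> carrier X"
  using map by (auto simp: blocale_maps_def frame_hom_def)

lemma f_top: "f \<top>\<^bsub>Y\<^esub> = \<top>\<^bsub>X\<^esub>"
  using map by (simp add: blocale_maps_def frame_hom_def)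

lemma f_Sup: "A \<subseteq> carrier Y \<Longrightarrow> f (\<Squnion>\<^bsub>Y\<^esub>A) = \<Squnion>\<^bsub>X\<^esub>(f ` A)"
  using map by (simp add: blocale_maps_def frame_hom_def sup_pres_def)

lemma f_meet: "\<lbrakk>y \<in> carrier Y; z \<in> carrier Y\<rbrakk> \<Longrightarrow> f (y \<sqinter>\<^bsub>Y\<^esub> z) = f y \<sqinter>\<^bsub>X\<^esub> f z"
  using map by (simp add: blocale_maps_def frame_hom_def meet_pres_def)

lemma f_act: "\<lbrakk>b \<in> carrier B; y \<in> carrier Y\<rbrakk> \<Longrightarrow> f (b \<cdot>\<^bsub>Y\<^esub> y) = b \<cdot>\<^bsub>X\<^esub> f y"
  using map by (simp add: blocale_maps_def bmodule_hom_def)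

lemma f_mono:
  assumes "y \<in> carrier Y" "z \<in> carrier Y" "y \<sqsubseteq>\<^bsub>Y\<^esub> z"
  shows "f y \<sqsubseteq>\<^bsub>X\<^esub> f z"
proof -
  have "f y \<sqinter>\<^bsub>X\<^esub> f z = f y"
    using f_meet[OF assms(1,2)] Y.X.meet_eq_left[OF assms] by simp
  then show ?thesis
    using X.X.meet_right[of "f y" "f z"] assms by simp
qed

text \<open>The elements \<open>f t\<close> with \<open>t\<close> a local section of
  \<open>Y\<close> cover \<open>X\<close> because \<open>f\<close> preserves joins and the top.
  Below such elements the direct image has an explicit formula, so arguments about it are localised
  to this cover.\<close>

lemma f_cover:
  "f ` local_sections B Y \<subseteq> carrier X" "\<Squnion>\<^bsub>X\<^esub>(f ` local_sections B Y) = \<top>\<^bsub>X\<^esub>"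
  using f_Sup[OF Y.local_sections_carrier] Y.Sup_local_sections f_top Y.local_sections_carrier
  by auto

text \<open>This is the universal property of f_! at \<open>s\<close>, with
  \<open>supp B X s \<cdot> t\<close> as its value, obtained before f_! is known to exist.\<close>

lemma act_section_le_iff:
  assumes s: "s \<in> carrier X" and t: "t \<in> local_sections B Y" "s \<sqsubseteq>\<^bsub>X\<^esub> f t"
    and y: "y \<in> carrier Y"
  shows "supp B X s \<cdot>\<^bsub>Y\<^esub> t \<sqsubseteq>\<^bsub>Y\<^esub> y \<longleftrightarrow> s \<sqsubseteq>\<^bsub>X\<^esub> f y"
proof
  have tc: "t \<in> carrier Y" using t Y.local_sections_carrier by auto
  have b: "supp B X s \<in> carrier B" using s by (rule X.supp_closed)
  have bt: "supp B X s \<cdot>\<^bsub>Y\<^esub> t \<in> carrier Y" using b tc by (rule Y.act_closed)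
  {
    assume "supp B X s \<cdot>\<^bsub>Y\<^esub> t \<sqsubseteq>\<^bsub>Y\<^esub> y"
    then have "f (supp B X s \<cdot>\<^bsub>Y\<^esub> t) \<sqsubseteq>\<^bsub>X\<^esub> f y"
      using f_mono[OF bt y] by simp
    \<comment> \<open>Linearity turns the right-hand side into \<open>supp B X s\<close> acting on
      \<open>f t\<close>, and \<open>s\<close> lies below \<open>f t\<close>.\<close>
    moreover have "s \<sqsubseteq>\<^bsub>X\<^esub> f (supp B X s \<cdot>\<^bsub>Y\<^esub> t)"
      using X.act_supp_of_le[OF s _ t(2)] f_act[OF b tc] tc by simp
    ultimately show "s \<sqsubseteq>\<^bsub>X\<^esub> f y"
      using X.X.le_trans[of s "f (supp B X s \<cdot>\<^bsub>Y\<^esub> t)" "f y"] s bt y by simp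
  next
    assume sy: "s \<sqsubseteq>\<^bsub>X\<^esub> f y"
    \<comment> \<open>As \<open>t\<close> is a local section, \<open>t \<sqinter> y\<close> equals
      \<open>c \<cdot> t\<close>. The bound on \<open>s\<close> thereby becomes a bound
      \<open>c\<close> on its support, which can be carried over to \<open>Y\<close>.\<close>
    define c where "c = supp B Y (t \<sqinter>\<^bsub>Y\<^esub> y)"
    have ty: "t \<sqinter>\<^bsub>Y\<^esub> y \<in> carrier Y" using tc y by simp
    then have c: "c \<in> carrier B" unfolding c_def by (rule Y.supp_closed)
    have ct: "c \<cdot>\<^bsub>Y\<^esub> t = t \<sqinter>\<^bsub>Y\<^esub> y"
      unfolding c_def by (rule Y.local_section_eq[OF t(1) ty Y.X.meet_left[OF tc y]])
    have "s \<sqsubseteq>\<^bsub>X\<^esub> f t \<sqinter>\<^bsub>X\<^esub> f y"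
      using X.X.le_meet_iff[of "f t" "f y" s] s tc y t(2) sy by simp
    then have "s \<sqsubseteq>\<^bsub>X\<^esub> c \<cdot>\<^bsub>X\<^esub> f t"
      using f_meet[OF tc y] f_act[OF c tc] ct by simp
    then have "supp B X s \<sqsubseteq>\<^bsub>B\<^esub> c"
      using X.le_act_iff[OF c _ s] tc by simp
    then have "supp B X s \<cdot>\<^bsub>Y\<^esub> t \<sqsubseteq>\<^bsub>Y\<^esub> t \<sqinter>\<^bsub>Y\<^esub> y"
      using Y.act_mono_left[OF b c tc] ct by simp
    then show "supp B X s \<cdot>\<^bsub>Y\<^esub> t \<sqsubseteq>\<^bsub>Y\<^esub> y"
      using Y.X.le_meet_iff[OF tc y bt] by simp
  }
qed

text \<open>The only candidate sends \<open>x\<close> to the meet of all \<open>y\<close> with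
  \<open>x \<le> f y\<close>. Since \<open>f\<close> is only known to preserve finite meets, the
  unit inequality \<open>x \<le> f (l x)\<close> is the point to prove; it is checked on the cover
  \<open>f_cover\<close>.\<close>

lemma ex_left_adjoint: "\<exists>l. is_left_adjoint X Y f l"
proof -
  let ?U = "\<lambda>x. {y \<in> carrier Y. x \<sqsubseteq>\<^bsub>X\<^esub> f y}"
  define l where "l = (\<lambda>x\<in>carrier X. \<Sqinter>\<^bsub>Y\<^esub>(?U x))"
  have l: "l x \<in> carrier Y" if "x \<in> carrier X" for x
    using that Y.X.inf_closed[of "?U x"] by (auto simp: l_def)
  have unit: "x \<sqsubseteq>\<^bsub>X\<^esub> f (l x)" if x: "x \<in> carrier X" for x
  proof (rule X.XF.le_if_cover[OF x _ f_cover])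
    show "f (l x) \<in> carrier X" using x l by simp
    fix u assume "u \<in> f ` local_sections B Y"
    then obtain t where t: "t \<in> local_sections B Y" and u: "u = f t" by auto
    have tc: "t \<in> carrier Y" using t Y.local_sections_carrier by auto
    let ?s = "x \<sqinter>\<^bsub>X\<^esub> f t"
    have s: "?s \<in> carrier X" "?s \<sqsubseteq>\<^bsub>X\<^esub> x" "?s \<sqsubseteq>\<^bsub>X\<^esub> f t"
      using x tc X.X.meet_left X.X.meet_right by auto
    note st = act_section_le_iff[OF s(1) t s(3)]
    have st_closed: "supp B X ?s \<cdot>\<^bsub>Y\<^esub> t \<in> carrier Y"
      using Y.act_closed[OF X.supp_closed[OF s(1)] tc] .
    \<comment> \<open>The explicit local value is a lower bound of the set whose meet is
      \<open>l x\<close>. Transposing \<open>supp B X ?s \<cdot> t \<le> l x\<close> back gives the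
      unit inequality on the piece \<open>?s\<close>.\<close>
    have "supp B X ?s \<cdot>\<^bsub>Y\<^esub> t \<sqsubseteq>\<^bsub>Y\<^esub> y" if y: "y \<in> ?U x" for y
      using y st[of y] X.X.le_trans[OF s(2), of "f y"] s x by simp
    then have "supp B X ?s \<cdot>\<^bsub>Y\<^esub> t \<sqsubseteq>\<^bsub>Y\<^esub> l x"
      using Y.X.le_inf_iff[OF _ st_closed, of "?U x"] x by (auto simp: l_def)
    then show "x \<sqinter>\<^bsub>X\<^esub> u \<sqsubseteq>\<^bsub>X\<^esub> f (l x)"
      using st[OF l[OF x]] u by simp
  qed
  have "is_left_adjoint X Y f l"
  proof (rule is_left_adjointI)
    show "partial_order X" "partial_order Y" by unfold_locales
    show "l \<in> carrier X \<rightarrow>\<^sub>E carrier Y" using l by (auto simp: l_def)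
    show "f \<in> carrier Y \<rightarrow> carrier X" by simp
    fix x y assume x: "x \<in> carrier X" and y: "y \<in> carrier Y"
    show "l x \<sqsubseteq>\<^bsub>Y\<^esub> y \<longleftrightarrow> x \<sqsubseteq>\<^bsub>X\<^esub> f y"
    proof
      assume "l x \<sqsubseteq>\<^bsub>Y\<^esub> y"
      then have "f (l x) \<sqsubseteq>\<^bsub>X\<^esub> f y" using f_mono[of "l x" y] l[OF x] y by simp
      then show "x \<sqsubseteq>\<^bsub>X\<^esub> f y"
        using X.X.le_trans[OF unit[OF x]] x y l by simp
    next
      assume "x \<sqsubseteq>\<^bsub>X\<^esub> f y"
      then show "l x \<sqsubseteq>\<^bsub>Y\<^esub> y"
        using Y.X.inf_lower[of "?U x" y] x y by (auto simp: l_def)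
    qed
  qed
  then show ?thesis by (rule exI[of _ l])
qed

section \<open>The Frobenius law and the direct image as a sheaf homomorphism\<close>

abbreviation l where "l \<equiv> left_adjoint X Y f"

lemma direct_image_adjoint: "is_left_adjoint X Y f l"
  using ex_left_adjoint left_adjoint_eq by metis

lemma l_closed [simp]: "x \<in> carrier X \<Longrightarrow> l x \<in> carrier Y"
  using is_left_adjointD(1)[OF direct_image_adjoint] by auto

lemma l_le_iff: "\<lbrakk>x \<in> carrier X; y \<in> carrier Y\<rbrakk> \<Longrightarrow> l x \<sqsubseteq>\<^bsub>Y\<^esub> y \<longleftrightarrow> x \<sqsubseteq>\<^bsub>X\<^esub> f y"
  using is_left_adjointD(3)[OF direct_image_adjoint] .

lemma l_sup_pres: "sup_pres X Y l"
  using is_left_adjoint_sup_pres[OF direct_image_adjoint X.X.complete_lattice_axioms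
      Y.X.complete_lattice_axioms] .

lemma l_section:
  assumes "s \<in> carrier X" "t \<in> local_sections B Y" "s \<sqsubseteq>\<^bsub>X\<^esub> f t"
  shows "l s = supp B X s \<cdot>\<^bsub>Y\<^esub> t"
proof (rule Y.X.eq_iff_upper)
  show "l s \<in> carrier Y" "supp B X s \<cdot>\<^bsub>Y\<^esub> t \<in> carrier Y"
    using assms Y.act_closed X.supp_closed Y.local_sections_carrier by auto
  show "l s \<sqsubseteq>\<^bsub>Y\<^esub> z \<longleftrightarrow> supp B X s \<cdot>\<^bsub>Y\<^esub> t \<sqsubseteq>\<^bsub>Y\<^esub> z" if "z \<in> carrier Y" for z
    using act_section_le_iff[OF assms that] l_le_iff[OF assms(1) that] by simp
qed

text \<open>Below \<open>f t\<close> both sides become actions on \<open>t\<close>: with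
  \<open>b\<close> the support of \<open>s\<close> and \<open>c\<close> that of
  \<open>t \<sqinter> y\<close>, each equals \<open>(b \<sqinter> c) \<cdot> t\<close>.\<close>

lemma frobenius_section:
  assumes s: "s \<in> carrier X" and t: "t \<in> local_sections B Y" "s \<sqsubseteq>\<^bsub>X\<^esub> f t"
    and y: "y \<in> carrier Y"
  shows "l (f y \<sqinter>\<^bsub>X\<^esub> s) = y \<sqinter>\<^bsub>Y\<^esub> l s"
proof -
  have tc: "t \<in> carrier Y" using t Y.local_sections_carrier by auto
  define b where "b = supp B X s"
  define c where "c = supp B Y (t \<sqinter>\<^bsub>Y\<^esub> y)"
  have ty: "t \<sqinter>\<^bsub>Y\<^esub> y \<in> carrier Y" using tc y by simp
  have b: "b \<in> carrier B" and c: "c \<in> carrier B"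
    unfolding b_def c_def using X.supp_closed[OF s] Y.supp_closed[OF ty] .
  have ct: "c \<cdot>\<^bsub>Y\<^esub> t = t \<sqinter>\<^bsub>Y\<^esub> y"
    unfolding c_def by (rule Y.local_section_eq[OF t(1) ty Y.X.meet_left[OF tc y]])
  have fs: "f t \<sqinter>\<^bsub>X\<^esub> s = s"
    using X.X.meet_eq_left[OF s _ t(2)] tc by (simp add: meet_comm)
  \<comment> \<open>Inserting \<open>f t\<close>, which lies above \<open>s\<close>, replaces
    \<open>f y\<close> by \<open>f (t \<sqinter> y)\<close>, that is, by \<open>c\<close> acting on
    \<open>f t\<close>.\<close>
  have "f y \<sqinter>\<^bsub>X\<^esub> s = (f y \<sqinter>\<^bsub>X\<^esub> f t) \<sqinter>\<^bsub>X\<^esub> s"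
    using X.X.meet_assoc[of "f y" "f t" s] y tc s fs by simp
  also have "\<dots> = c \<cdot>\<^bsub>X\<^esub> f t \<sqinter>\<^bsub>X\<^esub> s"
    using f_meet[OF tc y] f_act[OF c tc] ct meet_comm[of X "f y" "f t"] by simp
  also have "\<dots> = c \<cdot>\<^bsub>X\<^esub> s"
    using X.act_meet_distrib[OF c _ s, of "f t"] tc fs by simp
  finally have eq: "f y \<sqinter>\<^bsub>X\<^esub> s = c \<cdot>\<^bsub>X\<^esub> s" .
  have cs: "c \<cdot>\<^bsub>X\<^esub> s \<in> carrier X" using c s by (rule X.act_closed)
  have "c \<cdot>\<^bsub>X\<^esub> s \<sqsubseteq>\<^bsub>X\<^esub> f t"
    using X.X.le_trans[OF X.act_le[OF c s] t(2) cs s] tc by simp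
  then have "l (c \<cdot>\<^bsub>X\<^esub> s) = (b \<sqinter>\<^bsub>B\<^esub> c) \<cdot>\<^bsub>Y\<^esub> t"
    using l_section[OF cs t(1)] X.supp_act[OF c s] by (simp add: b_def meet_comm)
  also have "\<dots> = b \<cdot>\<^bsub>Y\<^esub> (t \<sqinter>\<^bsub>Y\<^esub> y)"
    using Y.act_meet[OF b c tc] ct by simp
  also have "\<dots> = y \<sqinter>\<^bsub>Y\<^esub> l s"
    using Y.act_meet_distrib[OF b tc y] l_section[OF s t] by (simp add: b_def meet_comm)
  finally show ?thesis using eq by simp
qed

text \<open>Glue the local case over the cover: \<open>l\<close> preserves joins, and so does
  meeting with \<open>y\<close> in the frame \<open>Y\<close>.\<close>

lemma frobenius:
  assumes x: "x \<in> carrier X" and y: "y \<in> carrier Y"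
  shows "l (f y \<sqinter>\<^bsub>X\<^esub> x) = y \<sqinter>\<^bsub>Y\<^esub> l x"
proof -
  let ?U = "f ` local_sections B Y"
  have sub: "(\<lambda>u. z \<sqinter>\<^bsub>X\<^esub> u) ` ?U \<subseteq> carrier X" if "z \<in> carrier X" for z
    using that f_cover(1) by auto
  have l_cover: "l z = \<Squnion>\<^bsub>Y\<^esub>((\<lambda>u. l (z \<sqinter>\<^bsub>X\<^esub> u)) ` ?U)" if z: "z \<in> carrier X" for z
  proof -
    have "l z = l (\<Squnion>\<^bsub>X\<^esub>((\<lambda>u. z \<sqinter>\<^bsub>X\<^esub> u) ` ?U))"
      using X.XF.eq_Sup_meet_cover[OF z f_cover] by (rule arg_cong[OF sym])
    also have "\<dots> = \<Squnion>\<^bsub>Y\<^esub>(l ` (\<lambda>u. z \<sqinter>\<^bsub>X\<^esub> u) ` ?U)"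
      using l_sup_pres sub[OF z] unfolding sup_pres_def by blast
    finally show ?thesis by (simp only: image_image)
  qed
  have "l (f y \<sqinter>\<^bsub>X\<^esub> x) = \<Squnion>\<^bsub>Y\<^esub>((\<lambda>u. l (f y \<sqinter>\<^bsub>X\<^esub> x \<sqinter>\<^bsub>X\<^esub> u)) ` ?U)"
    using l_cover x y by simp
  also have "(\<lambda>u. l (f y \<sqinter>\<^bsub>X\<^esub> x \<sqinter>\<^bsub>X\<^esub> u)) ` ?U = (\<lambda>u. y \<sqinter>\<^bsub>Y\<^esub> l (x \<sqinter>\<^bsub>X\<^esub> u)) ` ?U"
  proof (rule image_cong[OF refl])
    fix u assume "u \<in> ?U"
    then obtain t where t: "t \<in> local_sections B Y" and u: "u = f t" by auto
    have tc: "t \<in> carrier Y" using t Y.local_sections_carrier by auto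
    have s: "x \<sqinter>\<^bsub>X\<^esub> u \<in> carrier X" "x \<sqinter>\<^bsub>X\<^esub> u \<sqsubseteq>\<^bsub>X\<^esub> f t"
      unfolding u using x tc X.X.meet_right by auto
    have "f y \<sqinter>\<^bsub>X\<^esub> x \<sqinter>\<^bsub>X\<^esub> u = f y \<sqinter>\<^bsub>X\<^esub> (x \<sqinter>\<^bsub>X\<^esub> u)"
      using X.X.meet_assoc[of "f y" x u] x y u tc by simp
    then show "l (f y \<sqinter>\<^bsub>X\<^esub> x \<sqinter>\<^bsub>X\<^esub> u) = y \<sqinter>\<^bsub>Y\<^esub> l (x \<sqinter>\<^bsub>X\<^esub> u)"
      using frobenius_section[OF s(1) t s(2) y] by simp
  qed
  also have "\<Squnion>\<^bsub>Y\<^esub>\<dots> = y \<sqinter>\<^bsub>Y\<^esub> \<Squnion>\<^bsub>Y\<^esub>((\<lambda>u. l (x \<sqinter>\<^bsub>X\<^esub> u)) ` ?U)"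
  proof -
    have "(\<lambda>u. l (x \<sqinter>\<^bsub>X\<^esub> u)) ` ?U \<subseteq> carrier Y"
      using x f_cover(1) by (auto simp: image_subset_iff)
    from Y.XF.meet_Sup_distrib[OF y this] show ?thesis by (simp add: image_image)
  qed
  finally show ?thesis using l_cover[OF x] by simp
qed

text \<open>The Frobenius law at \<open>y = b \<cdot> \<top>\<close>, since in a
  \<open>B\<close>-locale acting by \<open>b\<close> is meeting with \<open>b \<cdot> \<top>\<close>
  and \<open>f\<close> carries this element of \<open>Y\<close> to that of \<open>X\<close>.\<close>

lemma l_act:
  assumes b: "b \<in> carrier B" and x: "x \<in> carrier X"
  shows "l (b \<cdot>\<^bsub>X\<^esub> x) = b \<cdot>\<^bsub>Y\<^esub> l x"
proof -
  have "b \<cdot>\<^bsub>X\<^esub> x = f (b \<cdot>\<^bsub>Y\<^esub> \<top>\<^bsub>Y\<^esub>) \<sqinter>\<^bsub>X\<^esub> x"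
    using X.act_eq_meet[OF b x] f_act[OF b] f_top by simp
  then have "l (b \<cdot>\<^bsub>X\<^esub> x) = (b \<cdot>\<^bsub>Y\<^esub> \<top>\<^bsub>Y\<^esub>) \<sqinter>\<^bsub>Y\<^esub> l x"
    using frobenius[OF x, of "b \<cdot>\<^bsub>Y\<^esub> \<top>\<^bsub>Y\<^esub>"] Y.act_closed[OF b] by simp
  then show ?thesis using Y.act_eq_meet[OF b, of "l x"] x by simp
qed

text \<open>Linearity of \<open>f\<close> says that f^* after the inverse image of the projection of
  \<open>Y\<close> is that of \<open>X\<close>; the left adjoints then compose accordingly.\<close>

lemma supp_l:
  assumes x: "x \<in> carrier X"
  shows "supp B Y (l x) = supp B X x"
proof (rule X.B.eq_iff_upper)
  fix b assume b: "b \<in> carrier B"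
  have "supp B Y (l x) \<sqsubseteq>\<^bsub>B\<^esub> b \<longleftrightarrow> l x \<sqsubseteq>\<^bsub>Y\<^esub> b \<cdot>\<^bsub>Y\<^esub> \<top>\<^bsub>Y\<^esub>"
    using Y.supp_le_iff[OF _ b, of "l x"] x by simp
  also have "\<dots> \<longleftrightarrow> x \<sqsubseteq>\<^bsub>X\<^esub> b \<cdot>\<^bsub>X\<^esub> \<top>\<^bsub>X\<^esub>"
    using l_le_iff[OF x, of "b \<cdot>\<^bsub>Y\<^esub> \<top>\<^bsub>Y\<^esub>"] Y.act_closed[OF b] f_act[OF b] f_top by simp
  finally show "supp B Y (l x) \<sqsubseteq>\<^bsub>B\<^esub> b \<longleftrightarrow> supp B X x \<sqsubseteq>\<^bsub>B\<^esub> b"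
    using X.supp_le_iff[OF x b] by simp
qed (use x X.supp_closed Y.supp_closed in auto)

lemma l_local_section:
  assumes s: "s \<in> local_sections B X"
  shows "l s \<in> local_sections B Y"
proof -
  have sc: "s \<in> carrier X" using s X.local_sections_carrier by auto
  have "supp B Y y \<cdot>\<^bsub>Y\<^esub> l s = y" if y: "y \<in> carrier Y" and le: "y \<sqsubseteq>\<^bsub>Y\<^esub> l s" for y
  proof -
    \<comment> \<open>By the Frobenius law this lift of \<open>y\<close> below \<open>s\<close>
      satisfies \<open>l x = y\<close>. The local section identity for \<open>x\<close> and
      \<open>s\<close> is then transported by the linear, support-preserving map
      \<open>l\<close>.\<close>
    define x where "x = f y \<sqinter>\<^bsub>X\<^esub> s"
    have x: "x \<in> carrier X" "x \<sqsubseteq>\<^bsub>X\<^esub> s"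
      using y sc X.X.meet_right[of "f y" s] by (auto simp: x_def)
    have lx: "l x = y"
      unfolding x_def using frobenius[OF sc y] Y.X.meet_eq_left[OF y _ le] sc by simp
    have "supp B X x \<cdot>\<^bsub>X\<^esub> s = x" by (rule X.local_section_eq[OF s x])
    then have "supp B X x \<cdot>\<^bsub>Y\<^esub> l s = y"
      using l_act[OF X.supp_closed[OF x(1)] sc] lx by simp
    then show ?thesis using supp_l[OF x(1)] lx by simp
  qed
  then show ?thesis using sc by (simp add: local_sections_def)
qed

lemma direct_image_sheaf_hom: "l \<in> sheaf_hom B X Y"
  using is_left_adjointD(1)[OF direct_image_adjoint] l_sup_pres l_act l_local_section supp_l
    X.local_sections_carrier
  by (auto simp: sheaf_hom_def bmodule_hom_def)

end


section \<open>The map of \<open>B\<close>-locales induced by a sheaf homomorphism\<close>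

locale blocale_sheaf_hom = X: etale_blocale B X + Y: etale_blocale B Y
  for B :: "('b, 'c) gorder_scheme" and X :: "('b, 'x) bmod" and Y :: "('b, 'y) bmod" +
  fixes h :: "'x \<Rightarrow> 'y"
  assumes hom: "h \<in> sheaf_hom B X Y"
begin

lemma h_PiE: "h \<in> carrier X \<rightarrow>\<^sub>E carrier Y"
  using hom by (simp add: sheaf_hom_def bmodule_hom_def)

lemma h_closed [simp]: "x \<in> carrier X \<Longrightarrow> h x \<in> carrier Y"
  using h_PiE by auto

lemma h_Sup: "A \<subseteq> carrier X \<Longrightarrow> h (\<Squnion>\<^bsub>X\<^esub>A) = \<Squnion>\<^bsub>Y\<^esub>(h ` A)"
  using hom by (simp add: sheaf_hom_def bmodule_hom_def sup_pres_def)

lemma h_act: "\<lbrakk>b \<in> carrier B; x \<in> carrier X\<rbrakk> \<Longrightarrow> h (b \<cdot>\<^bsub>X\<^esub> x) = b \<cdot>\<^bsub>Y\<^esub> h x"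
  using hom by (simp add: sheaf_hom_def bmodule_hom_def)

lemma h_local_section: "s \<in> local_sections B X \<Longrightarrow> h s \<in> local_sections B Y"
  using hom by (auto simp: sheaf_hom_def)

lemma supp_h_local_section: "s \<in> local_sections B X \<Longrightarrow> supp B Y (h s) = supp B X s"
  using hom by (simp add: sheaf_hom_def)

lemma h_mono:
  assumes "x \<in> carrier X" "y \<in> carrier X" "x \<sqsubseteq>\<^bsub>X\<^esub> y"
  shows "h x \<sqsubseteq>\<^bsub>Y\<^esub> h y"
proof -
  have "\<Squnion>\<^bsub>X\<^esub>{x, y} = y"
    using assms by (intro X.X.eq_iff_upper) (auto simp: X.X.sup_le_iff intro: X.X.le_trans)
  then have "h y = \<Squnion>\<^bsub>Y\<^esub>{h x, h y}"
    using h_Sup[of "{x, y}"] assms by simp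
  then show ?thesis
    using Y.X.sup_upper[of "{h x, h y}" "h x"] assms by simp
qed

text \<open>Meets with a cover by local sections are thus local sections themselves, which makes
  every element a join of local sections.\<close>

lemma meet_local_section:
  assumes "x \<in> carrier X" "s \<in> local_sections B X"
  shows "x \<sqinter>\<^bsub>X\<^esub> s \<in> local_sections B X"
proof -
  have "s \<in> carrier X" using assms X.local_sections_carrier by auto
  then show ?thesis
    using X.local_section_downward[OF assms(2), of "x \<sqinter>\<^bsub>X\<^esub> s"] X.X.meet_right assms by simp
qed

text \<open>Extends condition (2) from local sections to all elements: \<open>x\<close> is a join of
  local sections, and \<open>h\<close> and both supports preserve joins.\<close>

lemma supp_h:
  assumes x: "x \<in> carrier X"
  shows "supp B Y (h x) = supp B X x"
proof -
  let ?S = "(\<lambda>s. x \<sqinter>\<^bsub>X\<^esub> s) ` local_sections B X"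
  have S: "?S \<subseteq> local_sections B X" using meet_local_section[OF x] by auto
  then have Sc: "?S \<subseteq> carrier X" using X.local_sections_carrier by blast
  have eq: "\<Squnion>\<^bsub>X\<^esub>?S = x"
    using X.XF.eq_Sup_meet_cover[OF x X.local_sections_carrier X.Sup_local_sections] .
  have "supp B Y (h (\<Squnion>\<^bsub>X\<^esub>?S)) = \<Squnion>\<^bsub>B\<^esub>(supp B Y ` h ` ?S)"
    unfolding h_Sup[OF Sc] using Sc by (intro Y.supp_Sup) auto
  also have "supp B Y ` h ` ?S = supp B X ` ?S"
    unfolding image_image[of "supp B Y" h] using S supp_h_local_section
    by (intro image_cong) auto
  also have "\<Squnion>\<^bsub>B\<^esub>\<dots> = supp B X (\<Squnion>\<^bsub>X\<^esub>?S)"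
    using X.supp_Sup[OF Sc] by simp
  finally show ?thesis unfolding eq .
qed

text \<open>The standard formula for the right adjoint of a join-preserving map between complete
  lattices.\<close>

definition inverse_image :: "'y \<Rightarrow> 'x" where
  "inverse_image = (\<lambda>y\<in>carrier Y. \<Squnion>\<^bsub>X\<^esub>{x \<in> carrier X. h x \<sqsubseteq>\<^bsub>Y\<^esub> y})"

lemma inverse_image_closed [simp]: "y \<in> carrier Y \<Longrightarrow> inverse_image y \<in> carrier X"
  by (simp add: inverse_image_def)

lemma le_inv_image_iff:
  assumes x: "x \<in> carrier X" and y: "y \<in> carrier Y"
  shows "x \<sqsubseteq>\<^bsub>X\<^esub> inverse_image y \<longleftrightarrow> h x \<sqsubseteq>\<^bsub>Y\<^esub> y"
proof
  let ?U = "{x \<in> carrier X. h x \<sqsubseteq>\<^bsub>Y\<^esub> y}"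
  have U: "?U \<subseteq> carrier X" "h ` ?U \<subseteq> carrier Y" by auto
  {
    assume "x \<sqsubseteq>\<^bsub>X\<^esub> inverse_image y"
    then have "h x \<sqsubseteq>\<^bsub>Y\<^esub> h (inverse_image y)" using h_mono x y by simp
    moreover have "h (inverse_image y) \<sqsubseteq>\<^bsub>Y\<^esub> y"
      using h_Sup[OF U(1)] Y.X.sup_le_iff[OF U(2) y] y by (simp add: inverse_image_def)
    ultimately show "h x \<sqsubseteq>\<^bsub>Y\<^esub> y"
      using Y.X.le_trans[of "h x" "h (inverse_image y)" y] x y by simp
  next
    assume "h x \<sqsubseteq>\<^bsub>Y\<^esub> y"
    then show "x \<sqsubseteq>\<^bsub>X\<^esub> inverse_image y"
      using X.X.sup_upper[OF U(1), of x] x y by (simp add: inverse_image_def)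
  }
qed

lemma inverse_image_adjoint: "is_left_adjoint X Y inverse_image h"
proof (rule is_left_adjointI)
  show "partial_order X" "partial_order Y" by unfold_locales
qed (use h_PiE le_inv_image_iff in auto)

lemma inverse_image_mono:
  assumes "y \<in> carrier Y" "z \<in> carrier Y" "y \<sqsubseteq>\<^bsub>Y\<^esub> z"
  shows "inverse_image y \<sqsubseteq>\<^bsub>X\<^esub> inverse_image z"
proof -
  have "h (inverse_image y) \<sqsubseteq>\<^bsub>Y\<^esub> y"
    using le_inv_image_iff[of "inverse_image y" y] assms by simp
  then have "h (inverse_image y) \<sqsubseteq>\<^bsub>Y\<^esub> z"
    using Y.X.le_trans[of "h (inverse_image y)" y z] assms by simp
  then show ?thesis using le_inv_image_iff assms by simp
qed

text \<open>By \<open>le_act_iff\<close> and adjunction, both sides lie above \<open>x\<close>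
  exactly when \<open>h x \<le> y\<close> and a support is at most \<open>b\<close>: that of
  \<open>h x\<close> on the left, that of \<open>x\<close> on the right. These supports agree by
  \<open>supp_h\<close>.\<close>

lemma inverse_image_act:
  assumes b: "b \<in> carrier B" and y: "y \<in> carrier Y"
  shows "inverse_image (b \<cdot>\<^bsub>Y\<^esub> y) = b \<cdot>\<^bsub>X\<^esub> inverse_image y"
proof (rule X.X.eq_iff_lower)
  have by_closed: "b \<cdot>\<^bsub>Y\<^esub> y \<in> carrier Y" using b y by (rule Y.act_closed)
  then show "inverse_image (b \<cdot>\<^bsub>Y\<^esub> y) \<in> carrier X" by simp
  show "b \<cdot>\<^bsub>X\<^esub> inverse_image y \<in> carrier X" using X.act_closed b y by simp
  fix x assume x: "x \<in> carrier X"
  show "x \<sqsubseteq>\<^bsub>X\<^esub> inverse_image (b \<cdot>\<^bsub>Y\<^esub> y) \<longleftrightarrow> x \<sqsubseteq>\<^bsub>X\<^esub> b \<cdot>\<^bsub>X\<^esub> inverse_image y"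
    using le_inv_image_iff[OF x by_closed] le_inv_image_iff[OF x y] supp_h[OF x]
      Y.le_act_iff[OF b y, of "h x"] X.le_act_iff[OF b _ x, of "inverse_image y"] x y
    by simp
qed

lemma inverse_image_meet:
  assumes y: "y \<in> carrier Y" and z: "z \<in> carrier Y"
  shows "inverse_image (y \<sqinter>\<^bsub>Y\<^esub> z) = inverse_image y \<sqinter>\<^bsub>X\<^esub> inverse_image z"
  using assms
  by (intro X.X.eq_iff_lower) (simp_all add: le_inv_image_iff X.X.le_meet_iff Y.X.le_meet_iff)

lemma inverse_image_top: "inverse_image \<top>\<^bsub>Y\<^esub> = \<top>\<^bsub>X\<^esub>"
  by (intro X.X.eq_iff_lower) (simp_all add: le_inv_image_iff)

text \<open>One inequality is monotonicity. The other is local, and on local sections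
  \<open>h\<close> reflects a splitting of \<open>h s\<close> to a splitting of
  \<open>s\<close>.\<close>

lemma inverse_image_Sup:
  assumes A: "A \<subseteq> carrier Y"
  shows "inverse_image (\<Squnion>\<^bsub>Y\<^esub>A) = \<Squnion>\<^bsub>X\<^esub>(inverse_image ` A)"
proof (rule X.X.le_antisym)
  have uA: "inverse_image ` A \<subseteq> carrier X" using A by auto
  have SA: "\<Squnion>\<^bsub>Y\<^esub>A \<in> carrier Y" using A by simp
  show c: "inverse_image (\<Squnion>\<^bsub>Y\<^esub>A) \<in> carrier X" "\<Squnion>\<^bsub>X\<^esub>(inverse_image ` A) \<in> carrier X"
    using SA uA by auto
  have "inverse_image a \<sqsubseteq>\<^bsub>X\<^esub> inverse_image (\<Squnion>\<^bsub>Y\<^esub>A)" if "a \<in> A" for a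
    using inverse_image_mono[of a "\<Squnion>\<^bsub>Y\<^esub>A"] Y.X.sup_upper[OF A that] A SA that by auto
  then show "\<Squnion>\<^bsub>X\<^esub>(inverse_image ` A) \<sqsubseteq>\<^bsub>X\<^esub> inverse_image (\<Squnion>\<^bsub>Y\<^esub>A)"
    using X.X.sup_le_iff[OF uA c(1)] by auto
  show "inverse_image (\<Squnion>\<^bsub>Y\<^esub>A) \<sqsubseteq>\<^bsub>X\<^esub> \<Squnion>\<^bsub>X\<^esub>(inverse_image ` A)"
  proof (rule X.XF.le_if_cover[OF c X.local_sections_carrier X.Sup_local_sections])
    fix t assume t: "t \<in> local_sections B X"
    define s where "s = inverse_image (\<Squnion>\<^bsub>Y\<^esub>A) \<sqinter>\<^bsub>X\<^esub> t"
    have s: "s \<in> local_sections B X"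
      unfolding s_def by (rule meet_local_section[OF c(1) t])
    have tc: "t \<in> carrier X" and sc: "s \<in> carrier X" using s t X.local_sections_carrier by auto
    have hs: "h s \<in> carrier Y" using sc by simp
    have "s \<sqsubseteq>\<^bsub>X\<^esub> inverse_image (\<Squnion>\<^bsub>Y\<^esub>A)"
      unfolding s_def using c(1) tc by (rule X.X.meet_left)
    then have "h s \<sqsubseteq>\<^bsub>Y\<^esub> \<Squnion>\<^bsub>Y\<^esub>A" using le_inv_image_iff[OF sc SA] by simp
    then have hs_eq: "h s = \<Squnion>\<^bsub>Y\<^esub>((\<lambda>a. h s \<sqinter>\<^bsub>Y\<^esub> a) ` A)"
      using Y.X.meet_eq_left[OF hs SA] Y.XF.meet_Sup_distrib[OF hs A] by simp
    \<comment> \<open>These coefficients transport the splitting of \<open>h s\<close> into the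
      pieces \<open>h s \<sqinter> a\<close> back to \<open>X\<close>: their join is the support of
      \<open>s\<close>, and acting by its own support fixes \<open>s\<close>, so the pieces
      \<open>b a \<cdot> s\<close> cover \<open>s\<close>.\<close>
    define b where "b a = supp B Y (h s \<sqinter>\<^bsub>Y\<^esub> a)" for a
    have ha: "(\<lambda>a. h s \<sqinter>\<^bsub>Y\<^esub> a) ` A \<subseteq> carrier Y" using A hs by auto
    have b: "b a \<in> carrier B" if "a \<in> A" for a
      unfolding b_def using Y.supp_closed ha that by auto
    have bA: "b ` A \<subseteq> carrier B" using b by auto
    have "supp B X s = supp B Y (\<Squnion>\<^bsub>Y\<^esub>((\<lambda>a. h s \<sqinter>\<^bsub>Y\<^esub> a) ` A))"
      using supp_h[OF sc] hs_eq by simp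
    also have "\<dots> = \<Squnion>\<^bsub>B\<^esub>(b ` A)"
      unfolding Y.supp_Sup[OF ha] image_image b_def ..
    finally have "s = (\<Squnion>\<^bsub>B\<^esub>(b ` A)) \<cdot>\<^bsub>X\<^esub> s" using X.act_supp[OF sc] by simp
    then have s_eq: "s = \<Squnion>\<^bsub>X\<^esub>((\<lambda>a. b a \<cdot>\<^bsub>X\<^esub> s) ` A)"
      using X.act_Sup_left[OF bA sc] by (simp add: image_image)
    have "b a \<cdot>\<^bsub>X\<^esub> s \<sqsubseteq>\<^bsub>X\<^esub> \<Squnion>\<^bsub>X\<^esub>(inverse_image ` A)" if a: "a \<in> A" for a
    proof -
      have ac: "a \<in> carrier Y" using a A by auto
      have bs: "b a \<cdot>\<^bsub>X\<^esub> s \<in> carrier X" using X.act_closed[OF b[OF a] sc] .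
      \<comment> \<open>Here condition (1) enters: \<open>h s\<close> is a local section, so acting
        on it by the support of its part \<open>h s \<sqinter> a\<close> recovers that part.\<close>
      have "h (b a \<cdot>\<^bsub>X\<^esub> s) = h s \<sqinter>\<^bsub>Y\<^esub> a"
        unfolding h_act[OF b[OF a] sc] unfolding b_def
        using Y.local_section_eq[OF h_local_section[OF s] _ Y.X.meet_left[OF hs ac]] hs ac by simp
      then have "b a \<cdot>\<^bsub>X\<^esub> s \<sqsubseteq>\<^bsub>X\<^esub> inverse_image a"
        using le_inv_image_iff[OF bs ac] Y.X.meet_right[OF hs ac] by simp
      moreover have "inverse_image a \<sqsubseteq>\<^bsub>X\<^esub> \<Squnion>\<^bsub>X\<^esub>(inverse_image ` A)"
        using X.X.sup_upper[OF uA] a by simp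
      ultimately show ?thesis
        using X.X.le_trans[of "b a \<cdot>\<^bsub>X\<^esub> s" "inverse_image a" "\<Squnion>\<^bsub>X\<^esub>(inverse_image ` A)"] bs ac c(2)
        by simp
    qed
    moreover have "(\<lambda>a. b a \<cdot>\<^bsub>X\<^esub> s) ` A \<subseteq> carrier X"
      using X.act_closed[OF b sc] by auto
    ultimately have "\<Squnion>\<^bsub>X\<^esub>((\<lambda>a. b a \<cdot>\<^bsub>X\<^esub> s) ` A) \<sqsubseteq>\<^bsub>X\<^esub> \<Squnion>\<^bsub>X\<^esub>(inverse_image ` A)"
      using X.X.sup_le_iff[OF _ c(2)] by auto
    then show "inverse_image (\<Squnion>\<^bsub>Y\<^esub>A) \<sqinter>\<^bsub>X\<^esub> t \<sqsubseteq>\<^bsub>X\<^esub> \<Squnion>\<^bsub>X\<^esub>(inverse_image ` A)"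
      unfolding s_eq[symmetric] unfolding s_def .
  qed
qed

lemma inverse_image_blocale_map: "inverse_image \<in> blocale_maps B X Y"
proof -
  have "inverse_image \<in> carrier Y \<rightarrow>\<^sub>E carrier X"
    by (auto simp: inverse_image_def)
  moreover have "sup_pres Y X inverse_image"
    using inverse_image_Sup X.X.complete_lattice_axioms Y.X.complete_lattice_axioms
    by (simp add: sup_pres_def)
  moreover have "meet_pres Y X inverse_image"
    using inverse_image_meet X.X.complete_lattice_axioms Y.X.complete_lattice_axioms
    by (simp add: meet_pres_def)
  ultimately show ?thesis
    using inverse_image_act inverse_image_top
    by (simp add: blocale_maps_def frame_hom_def bmodule_hom_def)
qed

end


section \<open>The comparison functor\<close>

text \<open>Injectivity holds because a right adjoint is determined by its left adjoint. For
  surjectivity, \<open>h\<close> is the left adjoint of \<open>inverse_image\<close>, which is a map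
  of \<open>B\<close>-locales.\<close>

lemma left_adjoint_bij_betw:
  assumes "etale_blocale B X" "etale_blocale B Y"
  shows "bij_betw (left_adjoint X Y) (blocale_maps B X Y) (sheaf_hom B X Y)"
proof (rule bij_betw_imageI)
  interpret X: etale_blocale B X by fact
  interpret Y: etale_blocale B Y by fact
  have map: "blocale_map B X Y f" if "f \<in> blocale_maps B X Y" for f
    using that by unfold_locales
  show "inj_on (left_adjoint X Y) (blocale_maps B X Y)"
  proof (rule inj_onI)
    fix f g assume fg: "f \<in> blocale_maps B X Y" "g \<in> blocale_maps B X Y"
      and eq: "left_adjoint X Y f = left_adjoint X Y g"
    have "f \<in> extensional (carrier Y)" "g \<in> extensional (carrier Y)"
      using fg by (auto simp: blocale_maps_def frame_hom_def PiE_def)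
    then show "f = g"
      using is_left_adjoint_upper_unique blocale_map.direct_image_adjoint[OF map] fg eq by metis
  qed
  show "left_adjoint X Y ` blocale_maps B X Y = sheaf_hom B X Y"
  proof
    show "left_adjoint X Y ` blocale_maps B X Y \<subseteq> sheaf_hom B X Y"
      using blocale_map.direct_image_sheaf_hom[OF map] by auto
    show "sheaf_hom B X Y \<subseteq> left_adjoint X Y ` blocale_maps B X Y"
    proof
      fix h assume "h \<in> sheaf_hom B X Y"
      then interpret blocale_sheaf_hom B X Y h by unfold_locales
      show "h \<in> left_adjoint X Y ` blocale_maps B X Y"
        using left_adjoint_eq[OF inverse_image_adjoint, symmetric] inverse_image_blocale_map
        by (rule image_eqI)
    qed
  qed
qed

text \<open>A fully faithful functor that is bijective on objects has an inverse functor, built from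
  the set-theoretic inverses.\<close>

lemma iso_of_categoriesI:
  assumes F: "is_functor C D F"
    and obj: "bij_betw (ObjMap F) (Obj C) (Obj D)"
    and arr: "\<And>X Y. \<lbrakk>X \<in> Obj C; Y \<in> Obj C\<rbrakk>
      \<Longrightarrow> bij_betw (ArrMap F X Y) (Hom C X Y) (Hom D (ObjMap F X) (ObjMap F Y))"
  shows "iso_of_categories C D F"
proof -
  interpret is_functor C D F by fact
  define obj_inv where "obj_inv = inv_into (Obj C) (ObjMap F)"
  \<comment> \<open>Hom-sets may overlap, so the inverse is taken separately for each pair of
    objects.\<close>
  define arr_inv where "arr_inv P Q = inv_into (Hom C (obj_inv P) (obj_inv Q)) (ArrMap F (obj_inv P) (obj_inv Q))" for P Q
  define G where "G = \<lparr>ObjMap = obj_inv, ArrMap = arr_inv\<rparr>"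
  have obj_inv: "obj_inv P \<in> Obj C" "ObjMap F (obj_inv P) = P" if "P \<in> Obj D" for P
    using that obj by (auto simp: obj_inv_def bij_betw_def inv_into_into f_inv_into_f)
  have obj_inv_F: "obj_inv (ObjMap F X) = X" if "X \<in> Obj C" for X
    using that obj by (simp add: obj_inv_def bij_betw_def)
  have arr_inv: "arr_inv P Q g \<in> Hom C (obj_inv P) (obj_inv Q)" "ArrMap F (obj_inv P) (obj_inv Q) (arr_inv P Q g) = g"
    if "P \<in> Obj D" "Q \<in> Obj D" "g \<in> Hom D P Q" for P Q g
  proof -
    have "g \<in> ArrMap F (obj_inv P) (obj_inv Q) ` Hom C (obj_inv P) (obj_inv Q)"
      using arr[of "obj_inv P" "obj_inv Q"] obj_inv that by (simp add: bij_betw_def)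
    then show "arr_inv P Q g \<in> Hom C (obj_inv P) (obj_inv Q)" "ArrMap F (obj_inv P) (obj_inv Q) (arr_inv P Q g) = g"
      unfolding arr_inv_def by (rule inv_into_into, rule f_inv_into_f)
  qed
  \<comment> \<open>Faithfulness in usable form: an arrow mapped to \<open>g\<close> by the functor
    must be the chosen inverse of \<open>g\<close>. The functor laws of \<open>G\<close> thus follow
    by applying \<open>F\<close> to their right-hand sides.\<close>
  have arr_inv_eqI: "arr_inv P Q g = f"
    if "P \<in> Obj D" "Q \<in> Obj D" "f \<in> Hom C (obj_inv P) (obj_inv Q)" "g = ArrMap F (obj_inv P) (obj_inv Q) f" for P Q g f
    using that arr[of "obj_inv P" "obj_inv Q"] obj_inv by (simp add: arr_inv_def bij_betw_def)
  have "is_functor D C G"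
  proof
    show "ObjMap G P \<in> Obj C" if "P \<in> Obj D" for P
      using obj_inv that by (simp add: G_def)
    show "ArrMap G P Q g \<in> Hom C (ObjMap G P) (ObjMap G Q)"
      if "P \<in> Obj D" "Q \<in> Obj D" "g \<in> Hom D P Q" for P Q g
      using arr_inv that by (simp add: G_def)
    show "ArrMap G P P (Ident D P) = Ident C (ObjMap G P)" if "P \<in> Obj D" for P
      using that obj_inv C.ident_in_hom map_ident[of "obj_inv P"] by (simp add: G_def arr_inv_eqI)
    show "ArrMap G P R (Comp D P Q R g f) =
        Comp C (ObjMap G P) (ObjMap G Q) (ObjMap G R) (ArrMap G Q R g) (ArrMap G P Q f)"
      if "P \<in> Obj D" "Q \<in> Obj D" "R \<in> Obj D" "f \<in> Hom D P Q" "g \<in> Hom D Q R" for P Q R f g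
      using that obj_inv arr_inv C.comp_in_hom[of "obj_inv P" "obj_inv Q" "obj_inv R" "arr_inv P Q f" "arr_inv Q R g"]
        map_comp[of "obj_inv P" "obj_inv Q" "obj_inv R" "arr_inv P Q f" "arr_inv Q R g"]
      by (simp add: G_def arr_inv_eqI)
  qed
  moreover have "comp_is_identity C F G"
    unfolding comp_is_identity_def G_def
    using obj_inv_F by (auto intro!: arr_inv_eqI obj_map)
  moreover have "comp_is_identity D G F"
    using obj_inv arr_inv by (simp add: comp_is_identity_def G_def)
  ultimately show ?thesis
    using F by (auto simp: iso_of_categories_def)
qed

section \<open>Identities and composites of homomorphisms\<close>

lemma sup_pres_compose:
  assumes "sup_pres X Y f" "sup_pres Y Z g" "f \<in> carrier X \<rightarrow> carrier Y"
  shows "sup_pres X Z (compose (carrier X) g f)"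
proof -
  interpret X: complete_lattice X using assms(1) by (simp add: sup_pres_def)
  have "compose (carrier X) g f (\<Squnion>\<^bsub>X\<^esub>A) = \<Squnion>\<^bsub>Z\<^esub>(compose (carrier X) g f ` A)"
    if A: "A \<subseteq> carrier X" for A
  proof -
    have fA: "f ` A \<subseteq> carrier Y" using A assms(3) by auto
    have "compose (carrier X) g f (\<Squnion>\<^bsub>X\<^esub>A) = \<Squnion>\<^bsub>Z\<^esub>(g ` f ` A)"
      using assms(1,2) A fA by (simp add: sup_pres_def compose_eq)
    also have "g ` f ` A = compose (carrier X) g f ` A"
      using A by (auto simp: compose_eq subset_iff image_iff)
    finally show ?thesis .
  qed
  then show ?thesis using assms(1,2) by (simp add: sup_pres_def)
qed

lemma bmodule_hom_compose:
  assumes "f \<in> bmodule_hom B X Y" "g \<in> bmodule_hom B Y Z" "bmodule B X"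
  shows "compose (carrier X) g f \<in> bmodule_hom B X Z"
proof -
  interpret bmodule B X by fact
  have f: "f x \<in> carrier Y" if "x \<in> carrier X" for x
    using assms(1) that by (auto simp: bmodule_hom_def)
  have "sup_pres X Z (compose (carrier X) g f)"
    using assms(1,2) f by (intro sup_pres_compose[where Y = Y]) (auto simp: bmodule_hom_def)
  moreover have "compose (carrier X) g f \<in> carrier X \<rightarrow>\<^sub>E carrier Z"
    using assms(2) f by (auto simp: bmodule_hom_def compose_def)
  ultimately show ?thesis
    using assms(1,2) f act_closed by (simp add: bmodule_hom_def compose_eq)
qed

lemma bmodule_hom_ident:
  assumes "bmodule B X"
  shows "(\<lambda>x\<in>carrier X. x) \<in> bmodule_hom B X X"
proof -
  interpret bmodule B X by fact
  have "(\<lambda>x\<in>carrier X. x) ` A = A" if "A \<subseteq> carrier X" for A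
    using that by force
  then show ?thesis
    using act_closed X.complete_lattice_axioms by (simp add: bmodule_hom_def sup_pres_def)
qed

lemma frame_hom_compose:
  assumes f: "f \<in> frame_hom Y X" and g: "g \<in> frame_hom Z Y"
  shows "compose (carrier Z) f g \<in> frame_hom Z X"
proof -
  interpret Z: complete_lattice Z using g by (simp add: frame_hom_def sup_pres_def)
  have gc: "g z \<in> carrier Y" if "z \<in> carrier Z" for z
    using g that by (auto simp: frame_hom_def)
  have "sup_pres Z X (compose (carrier Z) f g)"
    using f g gc by (intro sup_pres_compose[where Y = Y]) (auto simp: frame_hom_def)
  moreover have "compose (carrier Z) f g \<in> carrier Z \<rightarrow>\<^sub>E carrier X"
    using f gc by (auto simp: frame_hom_def compose_def)
  ultimately show ?thesis
    using f g gc by (simp add: frame_hom_def meet_pres_def compose_eq)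
qed

lemma frame_hom_ident:
  assumes "complete_lattice X"
  shows "(\<lambda>x\<in>carrier X. x) \<in> frame_hom X X"
proof -
  interpret complete_lattice X by fact
  have "(\<lambda>x\<in>carrier X. x) ` A = A" if "A \<subseteq> carrier X" for A
    using that by force
  then show ?thesis
    using assms by (simp add: frame_hom_def sup_pres_def meet_pres_def)
qed

section \<open>The category laws\<close>

lemma LH_is_category: "is_category (LH B)"
proof
  fix W X Y Z :: "('b, 'a) bmod" and f g h :: "'a \<Rightarrow> 'a"
  note [simp] = LH_def
  {
    assume "X \<in> Obj (LH B)"
    then interpret X: etale_blocale B X by simp
    show "Ident (LH B) X \<in> Hom (LH B) X X"
      using bmodule_hom_ident[OF X.bmodule_axioms] frame_hom_ident[OF X.X.complete_lattice_axioms]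
      by (simp add: blocale_maps_def)
  next
    assume "Z \<in> Obj (LH B)" and fg: "f \<in> Hom (LH B) X Y" "g \<in> Hom (LH B) Y Z"
    \<comment> \<open>Arrows are inverse images, so the composite is a function on the carrier of
      \<open>Z\<close> and the closure laws are those of \<open>Z\<close>.\<close>
    then interpret Z: etale_blocale B Z by simp
    show "Comp (LH B) X Y Z g f \<in> Hom (LH B) X Z"
      using fg bmodule_hom_compose[OF _ _ Z.bmodule_axioms] frame_hom_compose
      by (auto simp: blocale_maps_def)
  next
    assume "f \<in> Hom (LH B) X Y"
    then have f: "f \<in> carrier Y \<rightarrow> carrier X" "f \<in> extensional (carrier Y)"
      by (auto simp: blocale_maps_def frame_hom_def PiE_def)
    then show "Comp (LH B) X X Y f (Ident (LH B) X) = f" "Comp (LH B) X Y Y (Ident (LH B) Y) f = f"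
      by (auto simp: Id_compose compose_Id)
  next
    \<comment> \<open>With composition reversed, \<open>h\<close> is the function applied first; its
      range makes the restricted composites associate.\<close>
    assume "h \<in> Hom (LH B) Y Z"
    then have "h \<in> carrier Z \<rightarrow> carrier Y"
      by (auto simp: blocale_maps_def frame_hom_def)
    then show "Comp (LH B) W Y Z h (Comp (LH B) W X Y g f) =
        Comp (LH B) W X Z (Comp (LH B) X Y Z h g) f"
      by (simp add: compose_assoc)
  }
qed

lemma Sh_is_category: "is_category (Sh B)"
proof
  fix W X Y Z :: "('b, 'a) bmod" and f g h :: "'a \<Rightarrow> 'a"
  note [simp] = Sh_def
  {
    assume "X \<in> Obj (Sh B)"
    then interpret X: etale_blocale B X by simp
    show "Ident (Sh B) X \<in> Hom (Sh B) X X"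
      using bmodule_hom_ident[OF X.bmodule_axioms] X.local_sections_carrier
      by (auto simp: sheaf_hom_def)
  next
    assume "X \<in> Obj (Sh B)" and fg: "f \<in> Hom (Sh B) X Y" "g \<in> Hom (Sh B) Y Z"
    then interpret X: etale_blocale B X by simp
    have "compose (carrier X) g f \<in> bmodule_hom B X Z"
      using fg bmodule_hom_compose[OF _ _ X.bmodule_axioms] by (auto simp: sheaf_hom_def)
    moreover have "compose (carrier X) g f s \<in> local_sections B Z"
      "supp B Z (compose (carrier X) g f s) = supp B X s" if s: "s \<in> local_sections B X" for s
    proof -
      have "s \<in> carrier X" "f s \<in> local_sections B Y"
        using s fg X.local_sections_carrier by (auto simp: sheaf_hom_def)
      then show "compose (carrier X) g f s \<in> local_sections B Z"
        "supp B Z (compose (carrier X) g f s) = supp B X s"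
        using s fg by (auto simp: sheaf_hom_def compose_eq)
    qed
    ultimately show "Comp (Sh B) X Y Z g f \<in> Hom (Sh B) X Z"
      by (auto simp: sheaf_hom_def)
  next
    assume "f \<in> Hom (Sh B) X Y"
    then have f: "f \<in> carrier X \<rightarrow> carrier Y" "f \<in> extensional (carrier X)"
      by (auto simp: sheaf_hom_def bmodule_hom_def PiE_def)
    then show "Comp (Sh B) X X Y f (Ident (Sh B) X) = f" "Comp (Sh B) X Y Y (Ident (Sh B) Y) f = f"
      by (auto simp: Id_compose compose_Id)
  next
    assume "f \<in> Hom (Sh B) W X"
    then have "f \<in> carrier W \<rightarrow> carrier X"
      by (auto simp: sheaf_hom_def bmodule_hom_def)
    then show "Comp (Sh B) W Y Z h (Comp (Sh B) W X Y g f) =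
        Comp (Sh B) W X Z (Comp (Sh B) X Y Z h g) f"
      by (simp add: compose_assoc)
  }
qed

text \<open>Functoriality is uniqueness of left adjoints: the identity is adjoint to itself, and the
  composite of two direct images is left adjoint to the composite of the inverse images in reverse
  order.\<close>

lemma S_is_functor: "is_functor (LH B) (Sh B) S_functor"
proof (rule is_functor.intro[OF LH_is_category Sh_is_category], unfold_locales)
  fix X Y Z :: "('b, 'a) bmod" and f g :: "'a \<Rightarrow> 'a"
  note [simp] = LH_def Sh_def S_functor_def
  have adj: "is_left_adjoint X Y f (left_adjoint X Y f)"
    if "X \<in> Obj (LH B)" "Y \<in> Obj (LH B)" "f \<in> Hom (LH B) X Y" for X Y :: "('b, 'a) bmod" and f
    using that
    by (intro blocale_map.direct_image_adjoint[of B] blocale_map.intro blocale_map_axioms.intro)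
      simp_all
  {
    assume "X \<in> Obj (LH B)"
    then show "ObjMap S_functor X \<in> Obj (Sh B)" by simp
  next
    assume "X \<in> Obj (LH B)" "Y \<in> Obj (LH B)" "f \<in> Hom (LH B) X Y"
    then show "ArrMap S_functor X Y f \<in> Hom (Sh B) (ObjMap S_functor X) (ObjMap S_functor Y)"
      using left_adjoint_bij_betw[of B X Y] by (auto simp: bij_betw_def)
  next
    assume "X \<in> Obj (LH B)"
    then interpret X: etale_blocale B X by simp
    show "ArrMap S_functor X X (Ident (LH B) X) = Ident (Sh B) (ObjMap S_functor X)"
      using left_adjoint_eq[OF is_left_adjoint_id[OF X.X.partial_order_axioms]] by simp
  next
    assume "X \<in> Obj (LH B)" "Y \<in> Obj (LH B)" "Z \<in> Obj (LH B)"
      "f \<in> Hom (LH B) X Y" "g \<in> Hom (LH B) Y Z"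
    then show "ArrMap S_functor X Z (Comp (LH B) X Y Z g f) =
        Comp (Sh B) (ObjMap S_functor X) (ObjMap S_functor Y) (ObjMap S_functor Z)
          (ArrMap S_functor Y Z g) (ArrMap S_functor X Y f)"
      using left_adjoint_eq[OF is_left_adjoint_compose[OF adj adj]] by simp
  }
qed

theorem theorem2p19:
  fixes B :: "('b, 'c) gorder_scheme"
  assumes "frame B"
  shows "iso_of_categories
    (LH B :: (('b, 'a) bmod, 'a \<Rightarrow> 'a) category)
    (Sh B :: (('b, 'a) bmod, 'a \<Rightarrow> 'a) category)
    S_functor"
proof (rule iso_of_categoriesI[OF S_is_functor])
  show "bij_betw (ObjMap S_functor) (Obj (LH B)) (Obj (Sh B))"
    by (simp add: S_functor_def LH_def Sh_def bij_betw_def)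
  show "bij_betw (ArrMap S_functor X Y) (Hom (LH B) X Y)
      (Hom (Sh B) (ObjMap S_functor X) (ObjMap S_functor Y))"
    if "X \<in> Obj (LH B)" "Y \<in> Obj (LH B)" for X Y :: "('b, 'a) bmod"
    using that left_adjoint_bij_betw[of B X Y] by (simp add: S_functor_def LH_def Sh_def)
qed

end
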